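(* There exists a sequence $(t_n)_{n\in\mathbb{N}}$ of positive real numbers converging to infinity such that for any $\alpha>0$ and $\delta\le 2\alpha$ and any $(\alpha,\delta)$-dilatively stable process $\{X(t),\,t\geq 0\}$ with zero mean, the following assertions hold for every $\kappa\in\mathbb{R}$. (i) If $\kappa<\alpha$ and, in case $\delta\leq 0$, the distribution of $X(1)$ has a Gaussian component (no requirement in case $\delta>0$), then $$\limsup_{n\to\infty}\frac{|X(t_n)|}{t_n^\kappa}=\infty\quad\text{almost surely.}$$ (ii) If $\kappa>\alpha$, then $$\limsup_{n\to\infty}\frac{|X(t_n)|}{t_n^\kappa}=0\quad\text{almost surely.}$$ Further, for any sequence $(t_n)_{n\in\mathbb{N}}$ with positive terms such that $\limsup_{n\to\infty}\sqrt[n]{1/t_n}<1$, the assertions (i) and (ii) hold (for all such processes).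
   Context: A process $\{X(t),t\ge0\}$ is real-valued; $\overset{\mathrm{fd}}{\sim}$ denotes equality of all finite-dimensional distributions. For a process $X$ all of whose finite-dimensional distributions are infinitely divisible and for $c>0$, $X^{\circledast c}=\{X(t),t\ge0\}^{\circledast c}$ denotes a process whose finite-dimensional distributions are the $c$-th convolution powers of the corresponding finite-dimensional distributions of $X$ (i.e. characteristic functions are raised to the power $c$). Let $\alpha>0$ and $\delta\leq 2\alpha$. A process $\{X(t),t\ge 0\}$ starting from zero ($X(0)=0$) is called $(\alpha,\delta)$-dilatively stable if its finite-dimensional distributions are infinitely divisible, $X(1)$ is non-Gaussian, $X(t)$ has finite moments of all orders for all $t\ge0$, and for all $T>0$, $X(T\,\cdot\,)\overset{\mathrm{fd}}{\sim}T^{\alpha-\delta/2}X^{\circledast T^\delta}(\,\cdot\,)$. Zero mean means $\mathsf{E}X(t)=0$ for all $t\geq 0$. An infinitely divisible distribution is said to have a Gaussian component if in its Lévy–Khintchine representation the Gaussian part has positive variance. *)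

theory Defs
  imports "HOL-Probability.Probability"
begin

section \<open>Processes and finite-dimensional distributions\<close>

text \<open>A process is a map \<open>X\<close> with \<open>X t \<omega>\<close> its value at time \<open>t\<close>. The time set is
  \<open>{0..}\<close>; the values of \<open>X\<close> at negative times are never looked at. The
  finite-dimensional distributions are indexed by finite sets of times.\<close>

definition is_process :: "'a measure \<Rightarrow> (real \<Rightarrow> 'a \<Rightarrow> real) \<Rightarrow> bool" where
  "is_process M X \<longleftrightarrow> prob_space M \<and> (\<forall>t\<ge>0. X t \<in> borel_measurable M)"

abbreviation R_space :: "real set \<Rightarrow> (real \<Rightarrow> real) measure" where
  "R_space J \<equiv> Pi\<^sub>M J (\<lambda>_. borel)"

definition fdd :: "'a measure \<Rightarrow> (real \<Rightarrow> 'a \<Rightarrow> real) \<Rightarrow> real set \<Rightarrow> (real \<Rightarrow> real) measure" where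
  "fdd M X J = distr M (R_space J) (\<lambda>\<omega>. \<lambda>t\<in>J. X t \<omega>)"

definition fd_equal ::
    "'a measure \<Rightarrow> (real \<Rightarrow> 'a \<Rightarrow> real) \<Rightarrow> 'b measure \<Rightarrow> (real \<Rightarrow> 'b \<Rightarrow> real) \<Rightarrow> bool" where
  "fd_equal M X N Y \<longleftrightarrow> (\<forall>J. finite J \<and> J \<subseteq> {0..} \<longrightarrow> fdd M X J = fdd N Y J)"


section \<open>Infinite divisibility and convolution powers\<close>

definition fd_convolution ::
    "real set \<Rightarrow> (real \<Rightarrow> real) measure \<Rightarrow> (real \<Rightarrow> real) measure \<Rightarrow> (real \<Rightarrow> real) measure" where
  "fd_convolution J \<mu> \<nu> = distr (\<mu> \<Otimes>\<^sub>M \<nu>) (R_space J) (\<lambda>(x, y). \<lambda>t\<in>J. x t + y t)"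

primrec fd_convolution_n ::
    "real set \<Rightarrow> (real \<Rightarrow> real) measure \<Rightarrow> nat \<Rightarrow> (real \<Rightarrow> real) measure" where
  "fd_convolution_n J \<nu> 0 = return (R_space J) (\<lambda>t\<in>J. 0)"
| "fd_convolution_n J \<nu> (Suc n) = fd_convolution J \<nu> (fd_convolution_n J \<nu> n)"

definition infinitely_divisible :: "real set \<Rightarrow> (real \<Rightarrow> real) measure \<Rightarrow> bool" where
  "infinitely_divisible J \<mu> \<longleftrightarrow>
     (\<forall>n\<ge>1. \<exists>\<nu>. prob_space \<nu> \<and> sets \<nu> = sets (R_space J) \<and> fd_convolution_n J \<nu> n = \<mu>)"

definition fd_char :: "real set \<Rightarrow> (real \<Rightarrow> real) measure \<Rightarrow> (real \<Rightarrow> real) \<Rightarrow> complex" where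
  "fd_char J \<mu> u = (CLINT x|\<mu>. iexp (\<Sum>t\<in>J. u t * x t))"

text \<open>\<open>\<nu>\<close> is the \<open>c\<close>-th convolution power of \<open>\<mu>\<close>. The real power of the characteristic function
  is taken with its distinguished logarithm \<open>\<psi>\<close>, the unique continuous logarithm vanishing at
  the origin. Continuity refers to the product topology on \<open>real \<Rightarrow> real\<close>; as this space is
  connected, \<open>\<psi>\<close> is unique, and, like the characteristic function, it depends only on the
  coordinates in \<open>J\<close>.\<close>

definition is_convolution_power ::
    "real set \<Rightarrow> real \<Rightarrow> (real \<Rightarrow> real) measure \<Rightarrow> (real \<Rightarrow> real) measure \<Rightarrow> bool" where
  "is_convolution_power J c \<mu> \<nu> \<longleftrightarrow>
     (\<exists>\<psi> :: (real \<Rightarrow> real) \<Rightarrow> complex. continuous_on UNIV \<psi> \<and> \<psi> (\<lambda>_. 0) = 0 \<and>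
        (\<forall>u. fd_char J \<mu> u = exp (\<psi> u)) \<and>
        (\<forall>u. fd_char J \<nu> u = exp (of_real c * \<psi> u)))"

definition convolution_power_process ::
    "real \<Rightarrow> 'a measure \<Rightarrow> (real \<Rightarrow> 'a \<Rightarrow> real) \<Rightarrow> 'b measure \<Rightarrow> (real \<Rightarrow> 'b \<Rightarrow> real) \<Rightarrow> bool" where
  "convolution_power_process c M X N Y \<longleftrightarrow> is_process N Y \<and>
     (\<forall>J. finite J \<and> J \<subseteq> {0..} \<longrightarrow> is_convolution_power J c (fdd M X J) (fdd N Y J))"


section \<open>Gaussian distributions and Gaussian components\<close>

text \<open>Point masses count as (degenerate) Gaussian distributions. In particular a process that
  vanishes identically is not dilatively stable.\<close>

definition gaussian :: "real measure \<Rightarrow> bool" where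
  "gaussian \<mu> \<longleftrightarrow> (\<exists>m. \<mu> = return borel m) \<or>
     (\<exists>m \<sigma>. 0 < \<sigma> \<and> \<mu> = density lborel (\<lambda>x. ennreal (normal_density m \<sigma> x)))"

definition levy_measure :: "real measure \<Rightarrow> bool" where
  "levy_measure \<nu> \<longleftrightarrow> sets \<nu> = sets borel \<and> emeasure \<nu> {0} = 0 \<and>
     (\<integral>\<^sup>+ x. ennreal (min 1 (x\<^sup>2)) \<partial>\<nu>) < \<infinity>"

definition levy_khintchine :: "real measure \<Rightarrow> real \<Rightarrow> real \<Rightarrow> real measure \<Rightarrow> bool" where
  "levy_khintchine \<mu> b v \<nu> \<longleftrightarrow> 0 \<le> v \<and> levy_measure \<nu> \<and>
     (\<forall>u. char \<mu> u = exp (\<i> * of_real (b * u) - of_real (v * u\<^sup>2 / 2) +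
        (CLINT x|\<nu>. iexp (u * x) - 1 - \<i> * of_real (u * x * indicator {-1..1} x))))"

definition has_gaussian_component :: "real measure \<Rightarrow> bool" where
  "has_gaussian_component \<mu> \<longleftrightarrow> (\<exists>b v \<nu>. levy_khintchine \<mu> b v \<nu> \<and> 0 < v)"


section \<open>Dilative stability\<close>

text \<open>The process \<open>X\<^sup>\<circledast>\<^sup>c\<close> is determined only up to its finite-dimensional distributions,
  so it may be realised on any sample space that is rich enough; path space always is.\<close>

definition dilatively_stable ::
    "real \<Rightarrow> real \<Rightarrow> 'a measure \<Rightarrow> (real \<Rightarrow> 'a \<Rightarrow> real) \<Rightarrow> bool" where
  "dilatively_stable \<alpha> \<delta> M X \<longleftrightarrow>
     0 < \<alpha> \<and> \<delta> \<le> 2 * \<alpha> \<and> is_process M X \<and>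
     (AE \<omega> in M. X 0 \<omega> = 0) \<and>
     (\<forall>J. finite J \<and> J \<subseteq> {0..} \<longrightarrow> infinitely_divisible J (fdd M X J)) \<and>
     \<not> gaussian (distr M borel (X 1)) \<and>
     (\<forall>t\<ge>0. \<forall>k::nat. integrable M (\<lambda>\<omega>. X t \<omega> ^ k)) \<and>
     (\<forall>T>0. \<exists>(N :: (real \<Rightarrow> real) measure) Y. convolution_power_process (T powr \<delta>) M X N Y \<and>
        fd_equal M (\<lambda>t. X (T * t)) N (\<lambda>t \<omega>. T powr (\<alpha> - \<delta> / 2) * Y t \<omega>))"

definition zero_mean :: "'a measure \<Rightarrow> (real \<Rightarrow> 'a \<Rightarrow> real) \<Rightarrow> bool" where
  "zero_mean M X \<longleftrightarrow> (\<forall>t\<ge>0. (LINT \<omega>|M. X t \<omega>) = 0)"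


section \<open>The two growth assertions\<close>

definition assertion_i ::
    "real \<Rightarrow> real \<Rightarrow> real \<Rightarrow> 'a measure \<Rightarrow> (real \<Rightarrow> 'a \<Rightarrow> real) \<Rightarrow> (nat \<Rightarrow> real) \<Rightarrow> bool" where
  "assertion_i \<alpha> \<delta> \<kappa> M X t \<longleftrightarrow>
     (\<kappa> < \<alpha> \<and> (\<delta> \<le> 0 \<longrightarrow> has_gaussian_component (distr M borel (X 1))) \<longrightarrow>
       (AE \<omega> in M. limsup (\<lambda>n. ereal (\<bar>X (t n) \<omega>\<bar> / t n powr \<kappa>)) = \<infinity>))"

definition assertion_ii ::
    "real \<Rightarrow> real \<Rightarrow> 'a measure \<Rightarrow> (real \<Rightarrow> 'a \<Rightarrow> real) \<Rightarrow> (nat \<Rightarrow> real) \<Rightarrow> bool" where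
  "assertion_ii \<alpha> \<kappa> M X t \<longleftrightarrow>
     (\<kappa> > \<alpha> \<longrightarrow>
       (AE \<omega> in M. limsup (\<lambda>n. ereal (\<bar>X (t n) \<omega>\<bar> / t n powr \<kappa>)) = 0))"


section \<open>Independence of the sample space\<close>

text \<open>In ``there is a sequence such that for every process'' the witness must not depend on the
  sample space, but a type variable for the sample space is quantified outside the existential
  quantifier. The theorem therefore demands the witness to work on the fixed type
  \<open>real \<Rightarrow> real\<close> of paths (as well as on \<open>'a\<close>). By the following transfer lemma, a sequence that
  works for all processes on path space works for all processes on every sample space.\<close>

lemma path_space_transfer:
  fixes M :: "'a measure" and X :: "real \<Rightarrow> 'a \<Rightarrow> real"
  defines "N \<equiv> distr M (R_space {0..}) (\<lambda>\<omega>. \<lambda>t\<in>{0..}. X t \<omega>)"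
    and "Y \<equiv> (\<lambda>t (x :: real \<Rightarrow> real). x t)"
  assumes ds: "dilatively_stable \<alpha> \<delta> M X" and zm: "zero_mean M X"
  shows "dilatively_stable \<alpha> \<delta> N Y" and "zero_mean N Y"
    and "(\<forall>n. 0 < t n) \<Longrightarrow> assertion_i \<alpha> \<delta> \<kappa> N Y t \<Longrightarrow> assertion_i \<alpha> \<delta> \<kappa> M X t"
    and "(\<forall>n. 0 < t n) \<Longrightarrow> assertion_ii \<alpha> \<kappa> N Y t \<Longrightarrow> assertion_ii \<alpha> \<kappa> M X t"
proof -
  have prob: "prob_space M" and X: "\<And>t. t \<ge> 0 \<Longrightarrow> X t \<in> borel_measurable M"
    using ds by (auto simp: dilatively_stable_def is_process_def)
  have P: "(\<lambda>\<omega>. \<lambda>t\<in>{0..}. X t \<omega>) \<in> M \<rightarrow>\<^sub>M R_space {0..}"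
    using X by (intro measurable_restrict) auto
  have Y: "Y s \<in> borel_measurable (R_space {0..})" if "s \<ge> 0" for s
    using that unfolding Y_def by (intro measurable_component_singleton) auto
  have Y': "Y s \<in> borel_measurable N" if "s \<ge> 0" for s
    using Y[OF that] by (simp add: N_def)
  have procN: "is_process N Y"
    using prob_space.prob_space_distr[OF prob P] Y' by (simp add: is_process_def N_def)
  have fdd_scale: "fdd N (\<lambda>t. Y (c * t)) J = fdd M (\<lambda>t. X (c * t)) J"
    if "J \<subseteq> {0..}" "c \<ge> 0" for J c
  proof -
    have "(\<lambda>x. \<lambda>t\<in>J. Y (c * t) x) \<in> R_space {0..} \<rightarrow>\<^sub>M R_space J"
      using that Y by (intro measurable_restrict) auto
    then show ?thesis
      unfolding fdd_def N_def
      by (subst distr_distr[OF _ P]) (use that in \<open>auto simp: Y_def intro!: distr_cong ext\<close>)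
  qed
  have fdd: "fdd N Y J = fdd M X J" if "J \<subseteq> {0..}" for J
    using fdd_scale[OF that, of 1] by simp
  have law: "distr N borel (Y s) = distr M borel (X s)" if "s \<ge> 0" for s
    unfolding N_def
    by (subst distr_distr[OF Y P]) (use that in \<open>auto simp: Y_def comp_def intro!: distr_cong\<close>)
  have AE_N: "(AE x in N. Q x) \<longleftrightarrow> (AE \<omega> in M. Q (\<lambda>t\<in>{0..}. X t \<omega>))"
    if "Measurable.pred (R_space {0..}) Q" for Q
    unfolding N_def using that by (intro AE_distr_iff[OF P]) (simp add: pred_def)
  show "dilatively_stable \<alpha> \<delta> N Y"
    unfolding dilatively_stable_def
  proof (intro conjI)
    show "AE x in N. Y 0 x = 0"
    proof (subst AE_N)
      show "Measurable.pred (R_space {0..}) (\<lambda>x. Y 0 x = 0)"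
        using Y[of 0] by measurable
      show "AE \<omega> in M. Y 0 (\<lambda>t\<in>{0..}. X t \<omega>) = 0"
        using ds by (auto simp: dilatively_stable_def Y_def)
    qed
    show "\<forall>t\<ge>0. \<forall>k::nat. integrable N (\<lambda>x. Y t x ^ k)"
    proof (intro allI impI)
      fix s :: real and k :: nat
      assume s: "s \<ge> 0"
      have "integrable M (\<lambda>\<omega>. Y s (\<lambda>t\<in>{0..}. X t \<omega>) ^ k)"
        using ds s by (simp add: dilatively_stable_def Y_def)
      then show "integrable N (\<lambda>x. Y s x ^ k)"
        unfolding N_def by (subst integrable_distr_eq[OF P]) (use Y[OF s] in auto)
    qed
    show "\<forall>T>0. \<exists>(N' :: (real \<Rightarrow> real) measure) Y'. convolution_power_process (T powr \<delta>) N Y N' Y' \<and>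
        fd_equal N (\<lambda>t. Y (T * t)) N' (\<lambda>t \<omega>. T powr (\<alpha> - \<delta> / 2) * Y' t \<omega>)"
    proof (intro allI impI)
      fix T :: real
      assume T: "T > 0"
      then obtain N' :: "(real \<Rightarrow> real) measure" and Y' where *:
        "convolution_power_process (T powr \<delta>) M X N' Y'"
        "fd_equal M (\<lambda>t. X (T * t)) N' (\<lambda>t \<omega>. T powr (\<alpha> - \<delta> / 2) * Y' t \<omega>)"
        using ds unfolding dilatively_stable_def by blast
      then have "convolution_power_process (T powr \<delta>) N Y N' Y'"
        "fd_equal N (\<lambda>t. Y (T * t)) N' (\<lambda>t \<omega>. T powr (\<alpha> - \<delta> / 2) * Y' t \<omega>)"
        using T by (auto simp: convolution_power_process_def fd_equal_def fdd fdd_scale)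
      then show "\<exists>(N' :: (real \<Rightarrow> real) measure) Y'. convolution_power_process (T powr \<delta>) N Y N' Y' \<and>
        fd_equal N (\<lambda>t. Y (T * t)) N' (\<lambda>t \<omega>. T powr (\<alpha> - \<delta> / 2) * Y' t \<omega>)"
        by blast
    qed
  qed (use ds procN in \<open>auto simp: dilatively_stable_def fdd law\<close>)
  show "zero_mean N Y"
    unfolding zero_mean_def
  proof (intro allI impI)
    fix s :: real
    assume s: "s \<ge> 0"
    have "(LINT x|N. Y s x) = (LINT \<omega>|M. Y s (\<lambda>t\<in>{0..}. X t \<omega>))"
      unfolding N_def using P Y[OF s] by (rule integral_distr)
    also have "\<dots> = 0"
      using zm s by (simp add: zero_mean_def Y_def)
    finally show "(LINT x|N. Y s x) = 0" .
  qed
  have AE_limsup: "(AE x in N. limsup (\<lambda>n. ereal (\<bar>Y (t n) x\<bar> / t n powr \<kappa>)) = c) \<longleftrightarrow>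
      (AE \<omega> in M. limsup (\<lambda>n. ereal (\<bar>X (t n) \<omega>\<bar> / t n powr \<kappa>)) = c)"
    if t: "\<forall>n. 0 < t n" for c
  proof (subst AE_N)
    have [measurable]: "Y (t n) \<in> borel_measurable (R_space {0..})" for n
      using t by (intro Y) (simp add: less_imp_le)
    show "Measurable.pred (R_space {0..})
        (\<lambda>x. limsup (\<lambda>n. ereal (\<bar>Y (t n) x\<bar> / t n powr \<kappa>)) = c)"
      by measurable
  qed (use t in \<open>simp add: Y_def less_imp_le\<close>)
  show "(\<forall>n. 0 < t n) \<Longrightarrow> assertion_i \<alpha> \<delta> \<kappa> N Y t \<Longrightarrow> assertion_i \<alpha> \<delta> \<kappa> M X t"
    by (simp add: assertion_i_def AE_limsup law)
  show "(\<forall>n. 0 < t n) \<Longrightarrow> assertion_ii \<alpha> \<kappa> N Y t \<Longrightarrow> assertion_ii \<alpha> \<kappa> M X t"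
    by (simp add: assertion_ii_def AE_limsup)
qed

end

theory Submission
  imports Defs
begin

text \<open>Only the moduli of the characteristic functions \<open>\<phi>\<^sub>T\<close> of \<open>X T\<close> matter: dilative stability gives
  \<open>ln \<bar>\<phi>\<^sub>T u\<bar> = T\<^sup>\<delta> ln \<bar>\<phi>\<^sub>1 (T\<^bsup>\<alpha> - \<delta>/2\<^esup> u)\<bar>\<close>. Expanding at the origin, \<open>X T\<close> has
  variance \<open>T\<^bsup>2\<alpha>\<^esup>\<close> times that of \<open>X 1\<close>. For \<open>\<kappa> > \<alpha>\<close> the second moments of \<open>X (t n) / t n powr \<kappa>\<close> are
  therefore summable, so these variables tend to \<open>0\<close> almost surely. For \<open>\<kappa> < \<alpha>\<close> it suffices
  that \<open>\<bar>X T\<bar> / T powr \<kappa>\<close> tends to infinity in probability. Averaging characteristic functions over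
  a standard normal variable \<open>N\<close> bounds the probability of \<open>\<bar>X T\<bar> \<le> r\<close> by a constant times
  the mean of \<open>\<bar>\<phi>\<^sub>T (N / r)\<bar>\<close>, which tends to \<open>0\<close> because \<open>ln \<bar>\<phi>\<^sub>1 h\<bar> \<le> - b h\<^sup>2\<close> for some \<open>b > 0\<close>:
  near \<open>0\<close> since \<open>X 1\<close> is not degenerate, and everywhere if \<open>X 1\<close> has a Gaussian component.\<close>

section \<open>Estimates for the characteristic function of one real distribution\<close>

lemma (in real_distribution) small_ball_le_char:
  assumes r: "0 < r"
  shows "prob {- r..r} \<le> exp (1 / 2) * (LINT y|std_normal_distribution. cmod (char M (y / r)))"
proof -
  let ?N = std_normal_distribution
  interpret N: real_distribution ?N
    by (rule real_dist_normal_dist)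
  interpret P: pair_prob_space M ?N ..
  \<comment> \<open>Inside the ball \<open>\<bar>x / r\<bar> \<le> 1\<close>, so the Gaussian kernel
    is at least \<open>exp (- 1 / 2)\<close> there; this is the source of the constant.\<close>
  have bound: "indicator {- r..r} x \<le> exp (1 / 2) * exp (- ((x / r)\<^sup>2) / 2)" for x :: real
  proof (cases "x \<in> {- r..r}")
    case True
    then have "\<bar>x / r\<bar> \<le> 1"
      using r by (auto simp: abs_le_iff field_simps)
    then have "(x / r)\<^sup>2 \<le> 1"
      by (simp only: abs_square_le_1)
    then have "1 \<le> exp (1 / 2 + - ((x / r)\<^sup>2) / 2)"
      by simp
    then show ?thesis
      using True by (simp only: exp_add indicator_simps)
  qed simp
  have int: "integrable M (\<lambda>x. exp (- ((x / r)\<^sup>2) / 2))"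
    by (intro integrable_const_bound[of _ 1]) auto
  have "prob {- r..r} = (LINT x|M. indicator {- r..r} x)"
    by simp
  also have "\<dots> \<le> (LINT x|M. exp (1 / 2) * exp (- ((x / r)\<^sup>2) / 2))"
    by (intro integral_mono bound integrable_mult_right int)
       (simp add: integrable_indicator_iff emeasure_eq_measure)
  also have "\<dots> = exp (1 / 2) * (LINT x|M. exp (- ((x / r)\<^sup>2) / 2))"
    by simp
  also have "(LINT x|M. exp (- ((x / r)\<^sup>2) / 2)) \<le> (LINT y|?N. cmod (char M (y / r)))"
  proof -
    have meas: "(\<lambda>y. char M (y / r)) \<in> borel_measurable ?N"
      by measurable
    \<comment> \<open>The kernel is the standard normal characteristic function at
      \<open>x / r\<close>. Fubini applies because the integrand has modulus 1 on a product of
      probability spaces.\<close>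
    have "complex_of_real (LINT x|M. exp (- ((x / r)\<^sup>2) / 2)) = (CLINT x|M. char ?N (x / r))"
      by (simp add: char_std_normal_distribution flip: of_real_exp)
    also have "\<dots> = (CLINT x|M. CLINT y|?N. iexp (x / r * y))"
      by (simp add: char_def)
    also have "\<dots> = (CLINT y|?N. CLINT x|M. iexp (x / r * y))"
      by (intro P.Fubini_integral[symmetric] P.integrable_const_bound[of _ 1]) (auto simp del: of_real_mult of_real_divide)
    also have "\<dots> = (CLINT y|?N. char M (y / r))"
      by (simp add: char_def mult.commute)
    finally have "\<bar>LINT x|M. exp (- ((x / r)\<^sup>2) / 2)\<bar> = cmod (CLINT y|?N. char M (y / r))"
      by (metis norm_of_real)
    also have "\<dots> \<le> (LINT y|?N. cmod (char M (y / r)))"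
      by (rule integral_norm_bound)
    finally show ?thesis
      by simp
  qed
  finally show ?thesis
    by simp
qed

text \<open>The third moment makes the Taylor remainder of \<open>char M\<close> cubic in
  \<open>h\<close>, so it disappears after division by \<open>h\<^sup>2\<close>; the zero mean
  removes the linear term.\<close>

lemma (in real_distribution) ln_char_asymp:
  assumes moments: "\<And>k. k \<le> 3 \<Longrightarrow> integrable M (\<lambda>x. x ^ k)"
    and mean: "expectation (\<lambda>x. x) = 0"
  shows "((\<lambda>h. ln (cmod (char M h)) / h\<^sup>2) \<longlongrightarrow> - expectation (\<lambda>x. x\<^sup>2) / 2) (at 0)"
proof -
  define v where "v = expectation (\<lambda>x. x\<^sup>2)"
  define C where "C = expectation (\<lambda>x. \<bar>x\<bar> ^ 3)"
  define z where "z h = cmod (char M h)" for h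
  have int: "integrable M (\<lambda>x. \<bar>x\<bar> ^ 3)" "integrable M (\<lambda>x. x\<^sup>2)" "integrable M (\<lambda>x. x)"
    using integrable_norm[OF moments[of 3]] moments[of 2] moments[of 1] by (auto simp: power_abs)
  have approx: "cmod (char M h - (1 - h\<^sup>2 * v / 2)) \<le> \<bar>h\<bar> ^ 3 * C" for h
  proof -
    have "cmod (char M h - (1 - h\<^sup>2 * v / 2)) \<le>
        h\<^sup>2 / 6 * expectation (\<lambda>x. min (6 * x\<^sup>2) (\<bar>h\<bar> * \<bar>x\<bar> ^ 3))"
      using char_approx3[OF int(3) mean int(2), of v h] mean by (simp add: v_def)
    also have "\<dots> \<le> h\<^sup>2 / 6 * expectation (\<lambda>x. \<bar>h\<bar> * \<bar>x\<bar> ^ 3)"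
      by (intro mult_left_mono integral_mono integrable_min integrable_mult_right int) auto
    also have "\<dots> = \<bar>h\<bar> ^ 3 * C / 6"
      by (simp add: C_def power2_eq_square power3_eq_cube)
    also have "\<dots> \<le> \<bar>h\<bar> ^ 3 * C"
      by (simp add: C_def)
    finally show ?thesis .
  qed
  have z0: "(z \<longlongrightarrow> 1) (at 0)"
    using tendsto_norm[OF isCont_char[of 0, unfolded isCont_def char_zero]] by (simp add: z_def[abs_def])
  have "((\<lambda>h. 1 - h\<^sup>2 * v / 2) \<longlongrightarrow> 1 - 0\<^sup>2 * v / 2) (at (0 :: real))"
    by (intro tendsto_intros) simp
  \<comment> \<open>Near the origin the real number \<open>1 - h\<^sup>2 * v / 2\<close> is its own
    modulus, so the reverse triangle inequality carries \<open>approx\<close> over to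
    \<open>z h\<close>.\<close>
  then have pos: "\<forall>\<^sub>F h in at 0. 0 < 1 - h\<^sup>2 * v / 2"
    by (rule order_tendstoD) simp
  have lim: "((\<lambda>h. (z h - 1) / h\<^sup>2) \<longlongrightarrow> - v / 2) (at 0)"
  proof (rule Lim_transform_eventually)
    show "((\<lambda>h. - v / 2 + (z h - (1 - h\<^sup>2 * v / 2)) / h\<^sup>2) \<longlongrightarrow> - v / 2) (at 0)"
    proof -
      have "((\<lambda>h. (z h - (1 - h\<^sup>2 * v / 2)) / h\<^sup>2) \<longlongrightarrow> 0) (at 0)"
      proof (rule Lim_null_comparison)
        show "((\<lambda>h. \<bar>h\<bar> * C) \<longlongrightarrow> 0) (at 0)"
          by (auto intro!: tendsto_eq_intros)
        show "\<forall>\<^sub>F h in at 0. norm ((z h - (1 - h\<^sup>2 * v / 2)) / h\<^sup>2) \<le> \<bar>h\<bar> * C"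
          using pos eventually_neq_at_within[of 0]
        proof eventually_elim
          case (elim h)
          have "\<bar>z h - (1 - h\<^sup>2 * v / 2)\<bar> = \<bar>cmod (char M h) - cmod (1 - h\<^sup>2 * v / 2)\<bar>"
          proof -
            have "complex_of_real 1 - of_real (h\<^sup>2 * v / 2) = of_real (1 - h\<^sup>2 * v / 2)"
              by simp
            then have "cmod (1 - h\<^sup>2 * v / 2) = 1 - h\<^sup>2 * v / 2"
              using elim(1) by (metis abs_of_pos norm_of_real of_real_1)
            then show ?thesis by (simp only: z_def)
          qed
          also have "\<dots> \<le> \<bar>h\<bar> ^ 3 * C"
            using norm_triangle_ineq3 approx by (rule order_trans)
          also have "\<dots> = \<bar>h\<bar> * C * h\<^sup>2"
            by (simp add: power3_eq_cube power2_eq_square)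
          finally show ?case
            using elim(2) by (simp add: abs_divide pos_divide_le_eq)
        qed
      qed
      from tendsto_add[OF tendsto_const this, of "- v / 2"] show ?thesis
        by simp
    qed
    show "\<forall>\<^sub>F h in at 0. - v / 2 + (z h - (1 - h\<^sup>2 * v / 2)) / h\<^sup>2 = (z h - 1) / h\<^sup>2"
      using eventually_neq_at_within[of 0] by eventually_elim (simp add: field_simps)
  qed
  have zpos: "\<forall>\<^sub>F h in at 0. 0 < z h"
    using z0 by (rule order_tendstoD) simp
  \<comment> \<open>The logarithm is squeezed by \<open>1 - 1 / z \<le> ln z \<le> z - 1\<close>;
    both outer quotients tend to \<open>- v / 2\<close> because \<open>z\<close> tends to 1.\<close>
  show ?thesis
    unfolding v_def[symmetric] z_def[symmetric]
  proof (rule tendsto_sandwich[OF _ _ _ lim])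
    show "((\<lambda>h. (z h - 1) / h\<^sup>2 / z h) \<longlongrightarrow> - v / 2) (at 0)"
      using tendsto_divide[OF lim z0] by simp
    show "\<forall>\<^sub>F h in at 0. (z h - 1) / h\<^sup>2 / z h \<le> ln (z h) / h\<^sup>2"
      using zpos
    proof eventually_elim
      case (elim h)
      have "(z h - 1) / z h \<le> ln (z h)"
        using ln_le_minus_one[of "1 / z h"] elim by (simp add: ln_div diff_divide_distrib)
      from divide_right_mono[OF this, of "h\<^sup>2"] show ?case
        by (simp add: mult.commute)
    qed
    show "\<forall>\<^sub>F h in at 0. ln (z h) / h\<^sup>2 \<le> (z h - 1) / h\<^sup>2"
      using zpos by eventually_elim (simp add: divide_right_mono ln_le_minus_one)
  qed
qed

section \<open>Dilative stability in terms of characteristic functions and moments\<close>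

lemma fd_char_fdd_singleton:
  assumes "X t \<in> borel_measurable M"
  shows "fd_char {t} (fdd M X {t}) u = char (distr M borel (X t)) (u t)"
  unfolding fd_char_def fdd_def char_def
  using assms by (subst (1 2) integral_distr) (auto intro!: measurable_restrict)

text \<open>The law of \<open>X T\<close> is the law at time 1 of the rescaled process, so the time
  set \<open>{1}\<close> suffices. A function of the form \<open>exp (\<psi> u)\<close> has no
  zeros, and passing to moduli leaves only \<open>Re \<psi>\<close>, the logarithm of the modulus:
  the choice of branch drops out.\<close>

lemma dilatively_stable_char:
  assumes ds: "dilatively_stable \<alpha> \<delta> M X" and T: "0 < T"
  shows "char (distr M borel (X 1)) u \<noteq> 0"
    and "cmod (char (distr M borel (X T)) u) =
      exp (T powr \<delta> * ln (cmod (char (distr M borel (X 1)) (T powr (\<alpha> - \<delta> / 2) * u))))"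
proof -
  define a where "a = T powr (\<alpha> - \<delta> / 2)"
  have X: "X t \<in> borel_measurable M" if "0 \<le> t" for t
    using ds that by (auto simp: dilatively_stable_def is_process_def)
  obtain N :: "(real \<Rightarrow> real) measure" and Y where
    conv: "convolution_power_process (T powr \<delta>) M X N Y" and
    eq: "fd_equal M (\<lambda>t. X (T * t)) N (\<lambda>t \<omega>. a * Y t \<omega>)"
    using ds T unfolding dilatively_stable_def a_def by blast
  have Y: "Y 1 \<in> borel_measurable N"
    using conv by (simp add: convolution_power_process_def is_process_def)
  obtain \<psi> where \<psi>: "\<And>u. fd_char {1} (fdd M X {1}) u = exp (\<psi> u)"
    "\<And>u. fd_char {1} (fdd N Y {1}) u = exp (of_real (T powr \<delta>) * \<psi> u)"
  proof -
    have "is_convolution_power {1} (T powr \<delta>) (fdd M X {1}) (fdd N Y {1})"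
      using conv by (simp add: convolution_power_process_def)
    then show thesis
      using that unfolding is_convolution_power_def by blast
  qed
  have c1: "char (distr M borel (X 1)) s = exp (\<psi> (\<lambda>_. s))" for s
    using \<psi>(1)[of "\<lambda>_. s"] X by (simp add: fd_char_fdd_singleton)
  show "char (distr M borel (X 1)) u \<noteq> 0"
    by (simp add: c1)
  have "char (distr M borel (X T)) u = fd_char {1} (fdd M (\<lambda>t. X (T * t)) {1}) (\<lambda>_. u)"
    using X T by (simp add: fd_char_fdd_singleton)
  also have "\<dots> = fd_char {1} (fdd N (\<lambda>t \<omega>. a * Y t \<omega>) {1}) (\<lambda>_. u)"
    using eq by (simp add: fd_equal_def)
  also have "\<dots> = char (distr N borel (\<lambda>\<omega>. a * Y 1 \<omega>)) u"
    using Y by (simp add: fd_char_fdd_singleton)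
  also have "\<dots> = char (distr N borel (Y 1)) (a * u)"
    using Y by (simp add: char_def integral_distr mult_ac)
  also have "\<dots> = exp (of_real (T powr \<delta>) * \<psi> (\<lambda>_. a * u))"
    using \<psi>(2)[of "\<lambda>_. a * u"] Y by (simp add: fd_char_fdd_singleton)
  finally show "cmod (char (distr M borel (X T)) u) =
      exp (T powr \<delta> * ln (cmod (char (distr M borel (X 1)) (T powr (\<alpha> - \<delta> / 2) * u))))"
    by (simp add: c1 a_def)
qed

text \<open>The compensator is imaginary, so the jump integrand has real part
  \<open>cos (u * x) - 1 \<le> 0\<close>: jumps only shrink the modulus, and the Gaussian factor
  bounds it.\<close>

lemma levy_khintchine_cmod_char_le:
  assumes "levy_khintchine \<mu> b v \<nu>"
  shows "cmod (char \<mu> u) \<le> exp (- v * u\<^sup>2 / 2)"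
proof -
  let ?f = "\<lambda>x. iexp (u * x) - 1 - \<i> * of_real (u * x * indicator {-1..1} x)"
  have "Re (CLINT x|\<nu>. ?f x) \<le> 0"
  proof (cases "integrable \<nu> ?f")
    case True
    then have "Re (CLINT x|\<nu>. ?f x) = (LINT x|\<nu>. Re (?f x))"
      by (rule integral_Re[symmetric])
    also have "\<dots> \<le> (LINT x|\<nu>. 0)"
      by (intro integral_mono integrable_Re True) (auto simp: Re_exp)
    finally show ?thesis
      by simp
  \<comment> \<open>A non-integrable integrand has integral 0 by convention, and the bound on the
    real part persists.\<close>
  qed (simp add: not_integrable_integral_eq)
  then show ?thesis
    using assms by (auto simp: levy_khintchine_def)
qed

lemma dilatively_stable_prob_space:
  assumes "dilatively_stable \<alpha> \<delta> M X"
  shows "prob_space M" and "0 \<le> t \<Longrightarrow> X t \<in> borel_measurable M"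
    and "0 \<le> t \<Longrightarrow> integrable M (\<lambda>\<omega>. X t \<omega> ^ k)"
  using assms by (auto simp: dilatively_stable_def is_process_def)

lemma dilatively_stable_ln_char_asymp:
  assumes ds: "dilatively_stable \<alpha> \<delta> M X" and zm: "zero_mean M X" and T: "0 \<le> T"
  shows "((\<lambda>h. ln (cmod (char (distr M borel (X T)) h)) / h\<^sup>2) \<longlongrightarrow>
    - (LINT \<omega>|M. (X T \<omega>)\<^sup>2) / 2) (at 0)"
proof -
  note [measurable] = dilatively_stable_prob_space(2)[OF ds T]
  interpret prob_space M
    by (rule dilatively_stable_prob_space(1)[OF ds])
  interpret D: real_distribution "distr M borel (X T)"
    by (rule real_distribution_distr) simp
  show ?thesis
    using D.ln_char_asymp dilatively_stable_prob_space(3)[OF ds T] zm T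
    by (simp add: integrable_distr_eq integral_distr zero_mean_def)
qed

text \<open>The limit at 0 of the log-modulus over \<open>h\<^sup>2\<close> is computed twice, from
  the moments of \<open>X T\<close> and from the scaling relation, where
  \<open>T powr \<delta> * a\<^sup>2\<close> equals \<open>T powr (2 * \<alpha>)\<close> and so
  eliminates \<delta>.\<close>

lemma dilatively_stable_second_moment:
  assumes ds: "dilatively_stable \<alpha> \<delta> M X" and zm: "zero_mean M X" and T: "0 < T"
  shows "(LINT \<omega>|M. (X T \<omega>)\<^sup>2) = T powr (2 * \<alpha>) * (LINT \<omega>|M. (X 1 \<omega>)\<^sup>2)"
proof -
  define a where "a = T powr (\<alpha> - \<delta> / 2)"
  define L where "L h = ln (cmod (char (distr M borel (X 1)) h)) / h\<^sup>2" for h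
  have a: "0 < a" and a2: "T powr (2 * \<alpha>) = T powr \<delta> * a\<^sup>2"
    using T by (auto simp: a_def power2_eq_square simp flip: powr_add)
  have "filterlim (\<lambda>h. a * h) (at 0) (at 0)"
    using a by (intro filterlim_atI) (auto intro!: tendsto_eq_intros simp: eventually_at_filter)
  then have "((\<lambda>h. T powr (2 * \<alpha>) * L (a * h)) \<longlongrightarrow>
      T powr (2 * \<alpha>) * (- (LINT \<omega>|M. (X 1 \<omega>)\<^sup>2) / 2)) (at 0)"
    using dilatively_stable_ln_char_asymp[OF ds zm, of 1] unfolding L_def[symmetric]
    by (intro tendsto_mult tendsto_const) (auto intro: filterlim_compose)
  moreover have "T powr (2 * \<alpha>) * L (a * h) = ln (cmod (char (distr M borel (X T)) h)) / h\<^sup>2" for h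
    using a by (simp add: dilatively_stable_char(2)[OF ds T] L_def a2 power_mult_distrib flip: a_def)
  ultimately have "((\<lambda>h. ln (cmod (char (distr M borel (X T)) h)) / h\<^sup>2) \<longlongrightarrow>
      T powr (2 * \<alpha>) * (- (LINT \<omega>|M. (X 1 \<omega>)\<^sup>2) / 2)) (at 0)"
    by simp
  from tendsto_unique[OF _ this dilatively_stable_ln_char_asymp[OF ds zm]] T show ?thesis
    by simp
qed

text \<open>A vanishing second moment would make \<open>X 1\<close> almost surely 0, and point
  masses count as \<open>gaussian\<close>.\<close>

lemma dilatively_stable_second_moment_pos:
  assumes ds: "dilatively_stable \<alpha> \<delta> M X"
  shows "0 < (LINT \<omega>|M. (X 1 \<omega>)\<^sup>2)"
proof (rule ccontr)
  have [measurable]: "X 1 \<in> borel_measurable M"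
    using dilatively_stable_prob_space(2)[OF ds] by simp
  interpret prob_space M
    by (rule dilatively_stable_prob_space(1)[OF ds])
  assume "\<not> 0 < (LINT \<omega>|M. (X 1 \<omega>)\<^sup>2)"
  moreover have "0 \<le> (LINT \<omega>|M. (X 1 \<omega>)\<^sup>2)"
    by simp
  ultimately have "(LINT \<omega>|M. (X 1 \<omega>)\<^sup>2) = 0"
    by linarith
  then have "AE \<omega> in M. (X 1 \<omega>)\<^sup>2 = 0"
    using dilatively_stable_prob_space(3)[OF ds, of 1 2]
    by (subst (asm) integral_nonneg_eq_0_iff_AE) auto
  then have "distr M borel (X 1) = distr M borel (\<lambda>_. 0)"
    by (intro distr_cong_AE) auto
  then have "gaussian (distr M borel (X 1))"
    by (auto simp: gaussian_def)
  then show False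
    using ds by (simp add: dilatively_stable_def)
qed

section \<open>Convergence to zero for exponents above \<alpha>\<close>

text \<open>As in the root test, eventually \<open>1 / t n \<le> q ^ n\<close> with
  \<open>q < 1\<close>, so a geometric series of ratio \<open>q powr \<beta>\<close>
  dominates.\<close>

lemma summable_powr_of_limsup_root:
  fixes t :: "nat \<Rightarrow> real"
  assumes pos: "\<And>n. 0 < t n" and limsup: "limsup (\<lambda>n. ereal (root n (1 / t n))) < 1" and \<beta>: "0 < \<beta>"
  shows "summable (\<lambda>n. t n powr - \<beta>)"
proof -
  obtain q where q: "limsup (\<lambda>n. ereal (root n (1 / t n))) < ereal q" "q < 1"
    using ereal_dense2[OF limsup] by auto
  \<comment> \<open>The sign of \<open>q\<close> is read off from a positive root below it, hence is
    carried along under the quantifier; \<open>n = 0\<close> is left out because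
    \<open>root 0\<close> is constantly 0.\<close>
  have "\<forall>\<^sub>F n in sequentially. 0 \<le> q \<and> norm (t n powr - \<beta>) \<le> (q powr \<beta>) ^ n"
    using Limsup_lessD[OF q(1)] eventually_gt_at_top[of 0]
  proof eventually_elim
    case (elim n)
    have root: "0 < root n (1 / t n)"
      using pos[of n] elim(2) by simp
    then have q0: "0 < q"
      using elim(1) by simp
    have "1 / t n = root n (1 / t n) ^ n"
      using pos[of n] elim(2) by simp
    also have "\<dots> \<le> q ^ n"
      using root elim(1) by (intro power_mono) auto
    finally have "(1 / t n) powr \<beta> \<le> (q ^ n) powr \<beta>"
      using pos[of n] \<beta> by (intro powr_mono2) auto
    also have "(q ^ n) powr \<beta> = (q powr \<beta>) ^ n"
      using q0 by (simp add: powr_powr mult.commute flip: powr_realpow)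
    finally show ?case
      using q0 pos[of n] by (simp add: powr_minus powr_divide inverse_eq_divide)
  qed
  then have le: "\<forall>\<^sub>F n in sequentially. norm (t n powr - \<beta>) \<le> (q powr \<beta>) ^ n" and "0 \<le> q"
    by (auto elim: eventually_mono dest: eventually_happens)
  then have "q powr \<beta> < 1"
    using powr_less_mono2[OF \<beta>, of q 1] q(2) by simp
  then show ?thesis
    using le by (intro summable_comparison_test_ev[OF le] summable_geometric) simp
qed

lemma dilatively_stable_tendsto_0:
  assumes ds: "dilatively_stable \<alpha> \<delta> M X" and zm: "zero_mean M X"
    and pos: "\<And>n. 0 < t n" and sum: "summable (\<lambda>n. t n powr - (2 * (\<kappa> - \<alpha>)))"
  shows "AE \<omega> in M. (\<lambda>n. \<bar>X (t n) \<omega>\<bar> / t n powr \<kappa>) \<longlonglongrightarrow> 0"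
proof -
  interpret prob_space M
    by (rule dilatively_stable_prob_space(1)[OF ds])
  have [measurable]: "X (t n) \<in> borel_measurable M" for n
    using dilatively_stable_prob_space(2)[OF ds] pos[of n] by simp
  define s where "s = (LINT \<omega>|M. (X 1 \<omega>)\<^sup>2)"
  define Z where "Z n \<omega> = (\<bar>X (t n) \<omega>\<bar> / t n powr \<kappa>)\<^sup>2" for n \<omega>
  have [measurable]: "Z n \<in> borel_measurable M" for n
    unfolding Z_def[abs_def] by measurable
  have Z_nonneg: "0 \<le> Z n \<omega>" for n \<omega>
    by (simp add: Z_def)
  have "integrable M (Z n)" for n
    using dilatively_stable_prob_space(3)[OF ds, of "t n" 2] pos[of n]
    by (simp add: Z_def[abs_def] power_divide)
  moreover have "(LINT \<omega>|M. Z n \<omega>) = t n powr - (2 * (\<kappa> - \<alpha>)) * s" for n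
    using pos[of n] dilatively_stable_second_moment[OF ds zm pos[of n]]
    by (simp add: Z_def power_divide s_def power2_eq_square algebra_simps powr_diff flip: powr_add)
  ultimately have "(\<integral>\<^sup>+ \<omega>. ennreal (Z n \<omega>) \<partial>M) = ennreal (t n powr - (2 * (\<kappa> - \<alpha>)) * s)" for n
    by (subst nn_integral_eq_integral) (simp_all add: Z_nonneg)
  \<comment> \<open>Exchanging sum and integral of nonnegative terms gives the random series of
    squares a finite mean, so it converges almost surely and its terms tend to 0.\<close>
  then have "(\<integral>\<^sup>+ \<omega>. (\<Sum>n. ennreal (Z n \<omega>)) \<partial>M) = (\<Sum>n. ennreal (t n powr - (2 * (\<kappa> - \<alpha>)) * s))"
    by (subst nn_integral_suminf) auto
  also have "\<dots> \<noteq> \<infinity>"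
    using summable_mult2[OF sum, of s] by (subst suminf_ennreal2) (auto simp: s_def)
  finally have "AE \<omega> in M. (\<Sum>n. ennreal (Z n \<omega>)) \<noteq> \<infinity>"
    by (intro nn_integral_PInf_AE) auto
  then show ?thesis
  proof eventually_elim
    case (elim \<omega>)
    then have "summable (\<lambda>n. Z n \<omega>)"
      by (intro summable_suminf_not_top) (simp_all add: Z_nonneg)
    then have "(\<lambda>n. sqrt (Z n \<omega>)) \<longlonglongrightarrow> sqrt 0"
      by (intro tendsto_real_sqrt summable_LIMSEQ_zero)
    then show ?case
      by (simp add: Z_def)
  qed
qed

section \<open>Escape to infinity in probability for exponents below \<alpha>\<close>

text \<open>The exponent is raised to \<open>\<kappa>'\<close> because for \<open>0 < \<delta>\<close> the bound on the
  characteristic function of \<open>X 1\<close> only holds near the origin, so the scaled argument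
  \<open>T powr (\<alpha> - \<delta> / 2 - \<kappa>') * y / K\<close> has to tend to \<open>0\<close>.\<close>

lemma dilatively_stable_char_tendsto_0:
  assumes ds: "dilatively_stable \<alpha> \<delta> M X" and zm: "zero_mean M X"
    and \<kappa>: "\<kappa> < \<alpha>" and gauss: "\<delta> \<le> 0 \<Longrightarrow> has_gaussian_component (distr M borel (X 1))"
    and K: "0 < K"
  obtains \<kappa>' where "\<kappa> \<le> \<kappa>'"
    and "\<And>y. y \<noteq> 0 \<Longrightarrow>
      ((\<lambda>T. cmod (char (distr M borel (X T)) (y / (K * T powr \<kappa>')))) \<longlongrightarrow> 0) at_top"
proof -
  define P where "P b h \<longleftrightarrow> ln (cmod (char (distr M borel (X 1)) h)) \<le> - b * h\<^sup>2" for b h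
  define h where "h \<kappa>' y T = T powr (\<alpha> - \<delta> / 2 - \<kappa>') * (y / K)" for \<kappa>' y T
  interpret prob_space M
    by (rule dilatively_stable_prob_space(1)[OF ds])
  interpret D: real_distribution "distr M borel (X 1)"
    using dilatively_stable_prob_space(2)[OF ds] by (intro real_distribution_distr) simp
  have "\<exists>b \<kappa>'. 0 < b \<and> \<kappa> \<le> \<kappa>' \<and> \<kappa>' < \<alpha> \<and> (\<forall>y. \<forall>\<^sub>F T in at_top. P b (h \<kappa>' y T))"
  proof (cases "\<delta> \<le> 0")
    case True
    then obtain b v \<nu> where lk: "levy_khintchine (distr M borel (X 1)) b v \<nu>" "0 < v"
      using gauss by (auto simp: has_gaussian_component_def)
    \<comment> \<open>The Gaussian component makes the bound global, so \<kappa> itself can serve as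
      \<open>\<kappa>'\<close>.\<close>
    have "P (v / 2) h" for h
    proof -
      have "ln (cmod (char (distr M borel (X 1)) h)) \<le> ln (exp (- v * h\<^sup>2 / 2))"
        using levy_khintchine_cmod_char_le[OF lk(1)] dilatively_stable_char(1)[OF ds zero_less_one]
        by (intro ln_mono) auto
      then show ?thesis
        by (simp add: P_def)
    qed
    with lk(2) \<kappa> show ?thesis
      by (intro exI[of _ "v / 2"] exI[of _ \<kappa>]) auto
  next
    case False
    define s where "s = (LINT \<omega>|M. (X 1 \<omega>)\<^sup>2)"
    have s: "0 < s"
      unfolding s_def by (rule dilatively_stable_second_moment_pos[OF ds])
    have "\<forall>\<^sub>F h in at 0. ln (cmod (char (distr M borel (X 1)) h)) / h\<^sup>2 < - (s / 4)"
      using dilatively_stable_ln_char_asymp[OF ds zm, of 1] s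
      by (intro order_tendstoD(2)) (auto simp flip: s_def)
    then have "\<forall>\<^sub>F h in at 0. P (s / 4) h"
      using eventually_neq_at_within[of 0]
      by eventually_elim (auto simp: P_def pos_divide_less_eq)
    \<comment> \<open>The limit only speaks of a punctured neighbourhood; the value at 0 is added
      because \<open>h \<kappa>' y T\<close> vanishes for \<open>y = 0\<close>.\<close>
    moreover have "P (s / 4) 0"
      by (simp add: P_def D.char_zero)
    ultimately have ev: "\<forall>\<^sub>F h in nhds 0. P (s / 4) h"
      by (auto simp: eventually_at_filter elim!: eventually_mono)
    \<comment> \<open>For \<open>0 < \<delta>\<close>, exceeding
      \<open>\<alpha> - \<delta> / 2\<close> makes the argument shrink, while staying below \<alpha>
      keeps the exponent \<open>2 * (\<alpha> - \<kappa>')\<close> positive;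
      \<open>\<alpha> - \<delta> / 4\<close> does both.\<close>
    define \<kappa>' where "\<kappa>' = max \<kappa> (\<alpha> - \<delta> / 4)"
    have "((\<lambda>T. T powr (\<alpha> - \<delta> / 2 - \<kappa>')) \<longlongrightarrow> 0) at_top"
      using False by (intro tendsto_neg_powr filterlim_ident) (simp add: \<kappa>'_def)
    then have "(h \<kappa>' y \<longlongrightarrow> 0) at_top" for y
      using tendsto_mult_left_zero unfolding h_def by blast
    then have "\<forall>\<^sub>F T in at_top. P (s / 4) (h \<kappa>' y T)" for y
      using ev by (metis filterlim_iff)
    with s \<kappa> False show ?thesis
      by (intro exI[of _ "s / 4"] exI[of _ \<kappa>']) (auto simp: \<kappa>'_def)
  qed
  then obtain b \<kappa>' where b: "0 < b" "\<kappa> \<le> \<kappa>'" "\<kappa>' < \<alpha>"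
    and P: "\<And>y. \<forall>\<^sub>F T in at_top. P b (h \<kappa>' y T)"
    by blast
  show thesis
  proof (rule that[OF b(2)])
    fix y :: real
    assume y: "y \<noteq> 0"
    show "((\<lambda>T. cmod (char (distr M borel (X T)) (y / (K * T powr \<kappa>')))) \<longlongrightarrow> 0) at_top"
    proof (rule tendsto_sandwich[OF _ _ tendsto_const])
      have "filterlim (\<lambda>T. (b * (y / K)\<^sup>2) * T powr (2 * (\<alpha> - \<kappa>'))) at_top at_top"
        using b y K
        by (intro filterlim_tendsto_pos_mult_at_top[OF tendsto_const] real_powr_at_top) auto
      then show "((\<lambda>T. exp (- ((b * (y / K)\<^sup>2) * T powr (2 * (\<alpha> - \<kappa>'))))) \<longlongrightarrow> 0) at_top"
        by (intro filterlim_compose[OF exp_at_bot] filterlim_compose[OF filterlim_uminus_at_bot_at_top])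
      show "\<forall>\<^sub>F T in at_top. cmod (char (distr M borel (X T)) (y / (K * T powr \<kappa>'))) \<le>
          exp (- ((b * (y / K)\<^sup>2) * T powr (2 * (\<alpha> - \<kappa>'))))"
        using P[of y] eventually_gt_at_top[of 0]
      proof eventually_elim
        case (elim T)
        have h: "T powr (\<alpha> - \<delta> / 2) * (y / (K * T powr \<kappa>')) = h \<kappa>' y T"
          by (simp add: h_def powr_diff)
        have "T powr \<delta> * ln (cmod (char (distr M borel (X 1)) (h \<kappa>' y T))) \<le>
            T powr \<delta> * (- b * (h \<kappa>' y T)\<^sup>2)"
          using elim(1) by (intro mult_left_mono) (auto simp: P_def)
        also have "\<dots> = - ((b * (y / K)\<^sup>2) * (T powr \<delta> * (T powr (\<alpha> - \<delta> / 2 - \<kappa>'))\<^sup>2))"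
          unfolding h_def power_mult_distrib by (simp add: mult_ac)
        also have "T powr \<delta> * (T powr (\<alpha> - \<delta> / 2 - \<kappa>'))\<^sup>2 = T powr (2 * (\<alpha> - \<kappa>'))"
          by (simp add: power2_eq_square algebra_simps flip: powr_add)
        finally show ?case
          unfolding dilatively_stable_char(2)[OF ds elim(2)] h by simp
      qed
    qed simp
  qed
qed

lemma dilatively_stable_prob_tendsto_0:
  assumes ds: "dilatively_stable \<alpha> \<delta> M X" and zm: "zero_mean M X"
    and \<kappa>: "\<kappa> < \<alpha>" and gauss: "\<delta> \<le> 0 \<Longrightarrow> has_gaussian_component (distr M borel (X 1))"
    and K: "0 < K"
  shows "((\<lambda>T. measure M {\<omega> \<in> space M. \<bar>X T \<omega>\<bar> \<le> K * T powr \<kappa>}) \<longlongrightarrow> 0) at_top"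
proof -
  let ?N = std_normal_distribution
  let ?\<phi> = "\<lambda>T. char (distr M borel (X T))"
  interpret prob_space M
    by (rule dilatively_stable_prob_space(1)[OF ds])
  interpret N: real_distribution ?N
    by (rule real_dist_normal_dist)
  have D: "real_distribution (distr M borel (X T))" if "0 \<le> T" for T
    using dilatively_stable_prob_space(2)[OF ds that] by (rule real_distribution_distr)
  obtain \<kappa>' where \<kappa>': "\<kappa> \<le> \<kappa>'"
    and lim: "\<And>y. y \<noteq> 0 \<Longrightarrow> ((\<lambda>T. cmod (?\<phi> T (y / (K * T powr \<kappa>')))) \<longlongrightarrow> 0) at_top"
    using dilatively_stable_char_tendsto_0[OF ds zm \<kappa> gauss K] by blast
  \<comment> \<open>Negative times are cut off because \<open>X\<close> is unconstrained there,
    while dominated convergence asks for measurability at every \<open>T\<close>.\<close>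
  define f where "f T y = (if 0 \<le> T then cmod (?\<phi> T (y / (K * T powr \<kappa>'))) else 0)" for T y
  have [measurable]: "f T \<in> borel_measurable ?N" for T
  proof (cases "0 \<le> T")
    case True
    have [measurable]: "?\<phi> T \<in> borel_measurable borel"
      by (rule real_distribution.char_measurable[OF D[OF True]])
    show ?thesis
      unfolding f_def[abs_def] by measurable
  qed (simp add: f_def[abs_def])
  have "((\<lambda>T. LINT y|?N. f T y) \<longlongrightarrow> (LINT y|?N. 0)) at_top"
  proof (rule integral_dominated_convergence_at_top[where w = "\<lambda>_. 1"])
    \<comment> \<open>The point \<open>y = 0\<close>, where the characteristic function is always 1,
      is a null set of the normal law.\<close>
    have "AE y in lborel. y \<noteq> (0 :: real)"
      by (rule AE_lborel_singleton)
    then have "AE y in ?N. y \<noteq> 0"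
      by (subst AE_density) auto
    then show "AE y in ?N. ((\<lambda>T. f T y) \<longlongrightarrow> 0) at_top"
    proof eventually_elim
      case (elim y)
      show ?case
        using lim[OF elim] by (rule Lim_transform_eventually)
          (use eventually_ge_at_top[of 0] in \<open>eventually_elim, simp add: f_def\<close>)
    qed
    show "\<forall>\<^sub>F T in at_top. AE y in ?N. norm (f T y) \<le> 1"
      by (auto simp: f_def real_distribution.cmod_char_le_1[OF D])
  qed auto
  from tendsto_mult_right_zero[OF this[unfolded integral_zero], of "exp (1 / 2)"]
  have up: "((\<lambda>T. exp (1 / 2) * (LINT y|?N. f T y)) \<longlongrightarrow> 0) at_top" .
  show ?thesis
  proof (rule tendsto_sandwich[OF _ _ tendsto_const up])
    show "\<forall>\<^sub>F T in at_top. measure M {\<omega> \<in> space M. \<bar>X T \<omega>\<bar> \<le> K * T powr \<kappa>} \<le>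
        exp (1 / 2) * (LINT y|?N. f T y)"
      using eventually_ge_at_top[of 1]
    proof eventually_elim
      case (elim T)
      then have T: "0 \<le> T" and r: "0 < K * T powr \<kappa>'"
        using K by auto
      note [measurable] = dilatively_stable_prob_space(2)[OF ds T]
      have "K * T powr \<kappa> \<le> K * T powr \<kappa>'"
        using elim \<kappa>' K by (simp add: powr_mono)
      then have "measure M {\<omega> \<in> space M. \<bar>X T \<omega>\<bar> \<le> K * T powr \<kappa>} \<le>
          measure M (X T -` {- (K * T powr \<kappa>')..K * T powr \<kappa>'} \<inter> space M)"
        by (intro finite_measure_mono) (auto simp: abs_le_iff)
      also have "\<dots> = measure (distr M borel (X T)) {- (K * T powr \<kappa>')..K * T powr \<kappa>'}"
        by (simp add: measure_distr)
      also have "\<dots> \<le> exp (1 / 2) * (LINT y|?N. f T y)"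
        using real_distribution.small_ball_le_char[OF D[OF T] r] T by (simp add: f_def)
      finally show ?case .
    qed
  qed simp
qed

section \<open>Almost sure statements along the sequence\<close>

text \<open>A finite limsup means a bound \<open>k\<close> from some index \<open>m\<close> on. Such
  an event lies in each later event that \<open>Z n\<close> is bounded, and these have probabilities
  tending to 0; there are countably many pairs \<open>m\<close>, \<open>k\<close>.\<close>

lemma (in prob_space) AE_limsup_abs_eq_PInf:
  fixes Z :: "nat \<Rightarrow> 'a \<Rightarrow> real"
  assumes [measurable]: "\<And>n. Z n \<in> borel_measurable M"
    and lim: "\<And>K. 0 < K \<Longrightarrow> (\<lambda>n. prob {\<omega> \<in> space M. \<bar>Z n \<omega>\<bar> \<le> K}) \<longlonglongrightarrow> 0"
  shows "AE \<omega> in M. limsup (\<lambda>n. ereal \<bar>Z n \<omega>\<bar>) = \<infinity>"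
proof -
  have "AE \<omega> in M. \<not> (\<forall>n\<ge>m. \<bar>Z n \<omega>\<bar> \<le> real k)" for m k
  proof -
    let ?A = "{\<omega> \<in> space M. \<forall>n\<ge>m. \<bar>Z n \<omega>\<bar> \<le> real k}"
    \<comment> \<open>The bound is relaxed to \<open>real k + 1\<close> since \<open>lim\<close>
      asks for a positive one and \<open>k\<close> may be 0.\<close>
    have "prob ?A \<le> 0"
    proof (rule tendsto_lowerbound)
      show "(\<lambda>n. prob {\<omega> \<in> space M. \<bar>Z n \<omega>\<bar> \<le> real k + 1}) \<longlonglongrightarrow> 0"
        by (rule lim) simp
      show "\<forall>\<^sub>F n in sequentially. prob ?A \<le> prob {\<omega> \<in> space M. \<bar>Z n \<omega>\<bar> \<le> real k + 1}"
        using eventually_ge_at_top[of m]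
        by eventually_elim (intro finite_measure_mono, fastforce, measurable)
    qed simp
    then have "prob ?A = 0"
      by (simp add: measure_le_0_iff)
    then have "AE \<omega> in M. \<omega> \<notin> ?A"
      by (subst (asm) prob_eq_0) auto
    with AE_space show ?thesis
      by eventually_elim auto
  qed
  then have "AE \<omega> in M. \<forall>m k. \<not> (\<forall>n\<ge>m. \<bar>Z n \<omega>\<bar> \<le> real k)"
    by (intro AE_all_countable[THEN iffD2] allI)
  then show ?thesis
  proof eventually_elim
    case (elim \<omega>)
    show ?case
    proof (rule ccontr)
      assume "limsup (\<lambda>n. ereal \<bar>Z n \<omega>\<bar>) \<noteq> \<infinity>"
      then obtain k :: nat where "limsup (\<lambda>n. ereal \<bar>Z n \<omega>\<bar>) < ereal (real k)"
        using less_PInf_Ex_of_nat by (metis ereal_less_PInfty ereal_less_eq(1) not_le)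
      from Limsup_lessD[OF this] show False
        using elim by (force simp: eventually_sequentially intro: less_imp_le)
    qed
  qed
qed

lemma dilatively_stable_assertions:
  fixes t :: "nat \<Rightarrow> real"
  assumes pos: "\<And>n. 0 < t n" and limsup: "limsup (\<lambda>n. ereal (root n (1 / t n))) < 1"
    and ds: "dilatively_stable \<alpha> \<delta> M X" and zm: "zero_mean M X"
  shows "assertion_i \<alpha> \<delta> \<kappa> M X t" and "assertion_ii \<alpha> \<kappa> M X t"
proof -
  note summable = summable_powr_of_limsup_root[OF pos limsup]
  interpret prob_space M
    by (rule dilatively_stable_prob_space(1)[OF ds])
  have [measurable]: "X (t n) \<in> borel_measurable M" for n
    using dilatively_stable_prob_space(2)[OF ds] pos[of n] by simp
  \<comment> \<open>Summability with exponent \<open>\<beta> = 1\<close> forces \<open>t n\<close>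
    to infinity, so limits in \<open>T\<close> can be restricted to the sequence.\<close>
  have "(\<lambda>n. inverse (t n)) \<longlonglongrightarrow> 0"
    using summable_LIMSEQ_zero[OF summable[of 1]] pos by (simp add: powr_minus less_imp_le)
  from filterlim_inverse_at_top[OF this] have top: "filterlim t at_top sequentially"
    using pos by simp
  show "assertion_i \<alpha> \<delta> \<kappa> M X t"
    unfolding assertion_i_def
  proof
    assume *: "\<kappa> < \<alpha> \<and> (\<delta> \<le> 0 \<longrightarrow> has_gaussian_component (distr M borel (X 1)))"
    have "AE \<omega> in M. limsup (\<lambda>n. ereal \<bar>X (t n) \<omega> / t n powr \<kappa>\<bar>) = \<infinity>"
    proof (rule AE_limsup_abs_eq_PInf)
      fix K :: real
      assume "0 < K"
      then have "(\<lambda>n. prob {\<omega> \<in> space M. \<bar>X (t n) \<omega>\<bar> \<le> K * t n powr \<kappa>}) \<longlonglongrightarrow> 0"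
        using * by (intro filterlim_compose[OF dilatively_stable_prob_tendsto_0[OF ds zm] top]) auto
      moreover have "0 < t n powr \<kappa>" for n
        using pos[of n] by simp
      ultimately show "(\<lambda>n. prob {\<omega> \<in> space M. \<bar>X (t n) \<omega> / t n powr \<kappa>\<bar> \<le> K}) \<longlonglongrightarrow> 0"
        by (simp add: pos_divide_le_eq)
    qed simp
    then show "AE \<omega> in M. limsup (\<lambda>n. ereal (\<bar>X (t n) \<omega>\<bar> / t n powr \<kappa>)) = \<infinity>"
      by simp
  qed
  show "assertion_ii \<alpha> \<kappa> M X t"
    unfolding assertion_ii_def
  proof
    assume "\<alpha> < \<kappa>"
    then have "AE \<omega> in M. (\<lambda>n. \<bar>X (t n) \<omega>\<bar> / t n powr \<kappa>) \<longlonglongrightarrow> 0"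
      by (intro dilatively_stable_tendsto_0[OF ds zm pos] summable) simp
    then show "AE \<omega> in M. limsup (\<lambda>n. ereal (\<bar>X (t n) \<omega>\<bar> / t n powr \<kappa>)) = 0"
    proof eventually_elim
      case (elim \<omega>)
      then have "(\<lambda>n. ereal (\<bar>X (t n) \<omega>\<bar> / t n powr \<kappa>)) \<longlonglongrightarrow> 0"
        by (simp add: zero_ereal_def)
      then show ?case
        by (intro lim_imp_Limsup) simp_all
    qed
  qed
qed

theorem lemma2p5:
  shows
    "(\<exists>t :: nat \<Rightarrow> real. (\<forall>n. 0 < t n) \<and> filterlim t at_top sequentially \<and>
        (\<forall>\<alpha> \<delta>. \<alpha> > 0 \<and> \<delta> \<le> 2 * \<alpha> \<longrightarrow>
          (\<forall>(M :: (real \<Rightarrow> real) measure) X. dilatively_stable \<alpha> \<delta> M X \<and> zero_mean M X \<longrightarrow>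
            (\<forall>\<kappa>. assertion_i \<alpha> \<delta> \<kappa> M X t \<and> assertion_ii \<alpha> \<kappa> M X t)) \<and>
          (\<forall>(M :: 'a measure) X. dilatively_stable \<alpha> \<delta> M X \<and> zero_mean M X \<longrightarrow>
            (\<forall>\<kappa>. assertion_i \<alpha> \<delta> \<kappa> M X t \<and> assertion_ii \<alpha> \<kappa> M X t))))
     \<and>
     (\<forall>t :: nat \<Rightarrow> real. (\<forall>n. 0 < t n) \<and> limsup (\<lambda>n. ereal (root n (1 / t n))) < 1 \<longrightarrow>
        (\<forall>\<alpha> \<delta>. \<alpha> > 0 \<and> \<delta> \<le> 2 * \<alpha> \<longrightarrow>
          (\<forall>(M :: 'a measure) X. dilatively_stable \<alpha> \<delta> M X \<and> zero_mean M X \<longrightarrow>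
            (\<forall>\<kappa>. assertion_i \<alpha> \<delta> \<kappa> M X t \<and> assertion_ii \<alpha> \<kappa> M X t))))"
proof (intro conjI exI[of _ "\<lambda>n. 2 ^ n"])
  \<comment> \<open>The witness \<open>2 ^ n\<close> has root limit 1/2, so existence is a special
    case of the criterion.\<close>
  have "\<forall>\<^sub>F n in sequentially. ereal (root n (1 / 2 ^ n)) \<le> ereal (1 / 2)"
    using eventually_gt_at_top[of 0]
    by eventually_elim (simp add: real_root_divide real_root_power_cancel)
  then have "limsup (\<lambda>n. ereal (root n (1 / 2 ^ n))) \<le> ereal (1 / 2)"
    by (rule Limsup_bounded)
  then have root: "limsup (\<lambda>n. ereal (root n (1 / 2 ^ n))) < 1"
    by (rule le_less_trans) simp
  show "filterlim (\<lambda>n. 2 ^ n :: real) at_top sequentially"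
    by real_asymp
  \<comment> \<open>The lemma is polymorphic in the sample space, so one witness serves path space
    and \<open>'a\<close> alike.\<close>
  note geom = dilatively_stable_assertions[of "\<lambda>n. 2 ^ n", OF _ root]
  show "\<forall>\<alpha> \<delta>. \<alpha> > 0 \<and> \<delta> \<le> 2 * \<alpha> \<longrightarrow>
      (\<forall>(M :: (real \<Rightarrow> real) measure) X. dilatively_stable \<alpha> \<delta> M X \<and> zero_mean M X \<longrightarrow>
        (\<forall>\<kappa>. assertion_i \<alpha> \<delta> \<kappa> M X (\<lambda>n. 2 ^ n) \<and> assertion_ii \<alpha> \<kappa> M X (\<lambda>n. 2 ^ n))) \<and>
      (\<forall>(M :: 'a measure) X. dilatively_stable \<alpha> \<delta> M X \<and> zero_mean M X \<longrightarrow>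
        (\<forall>\<kappa>. assertion_i \<alpha> \<delta> \<kappa> M X (\<lambda>n. 2 ^ n) \<and> assertion_ii \<alpha> \<kappa> M X (\<lambda>n. 2 ^ n)))"
    by (auto intro: geom)
qed (auto intro: dilatively_stable_assertions)

end
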